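(* Let $q$ be a power of $2$. Fix $\alpha\in\mathbb{F}_{q^2}\setminus\mathbb{F}_q$ such that $\operatorname{Tr}^{q^2}_q(\alpha)=1$. Let $b_1,b_2,c\in\mathbb{F}_q$ and $b=b_1+b_2\alpha\in\mathbb{F}_{q^2}$. When $b_2\neq c$, define $$\delta=\frac{c^2\alpha^{q+1}+cb_1}{(b_2+c)^2}\in\mathbb{F}_q .$$ Let $N(b,c)$ be the number of $x\in\mu_{q+1}\setminus\{-1\}$ with $\operatorname{Tr}^{q^2}_q(bx+b)+c=0$. Then $N(b,c)$ is equal to (i) $q$, if $b=0$, $c=0$; (ii) $0$, if $b=0$, $c\neq 0$; (iii) $0$, if $b\neq 0$, $c=0$, $b_2=0$; (iv) $1$, if $b\neq 0$, $c=0$, $b_2\neq 0$; (v) $1$, if $b\neq 0$, $c\neq 0$, $b_2=c$; (vi) $0$, if $b\neq 0$, $c\neq 0$, $b_2\neq c$, $\operatorname{Tr}^{q}_2(\delta)=1$; (vii) $2$, if $b\neq 0$, $c\neq 0$, $b_2\neq c$, $\operatorname{Tr}^{q}_2(\delta)=0$.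
   Context: $\mathbb{F}_r$ is the finite field with $r$ elements. $\operatorname{Tr}^{q^2}_q:\mathbb{F}_{q^2}\to\mathbb{F}_q$ is $\operatorname{Tr}^{q^2}_q(x)=x+x^q$, and $\operatorname{Tr}^q_2:\mathbb{F}_q\to\mathbb{F}_2$ is the absolute trace $\operatorname{Tr}^{q}_2(x)=x+x^2+x^4+\cdots+x^{q/2}$. $\mu_{q+1}=\{x\in\mathbb{F}_{q^2}:x^{q+1}=1\}$. Every element of $\mathbb{F}_{q^2}$ is uniquely of the form $b_1+b_2\alpha$ with $b_1,b_2\in\mathbb{F}_q$, and $\alpha^{q+1}\in\mathbb{F}_q$. *)

theory Defs
  imports "HOL-Library.Cardinality"
begin

definition is_subfield :: "'a::field set \<Rightarrow> bool" where
  "is_subfield K \<longleftrightarrow>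
     0 \<in> K \<and> 1 \<in> K \<and>
     (\<forall>x\<in>K. \<forall>y\<in>K. x + y \<in> K \<and> x * y \<in> K) \<and>
     (\<forall>x\<in>K. - x \<in> K \<and> inverse x \<in> K)"

text \<open>
  The ambient field \<open>'a\<close> plays the role of the field with \<open>q\<^sup>2\<close> elements. Both traces are
  regarded as maps into \<open>'a\<close>, via the inclusions of the fields with 2 and \<open>q\<close> elements.
\<close>

definition rel_trace :: "nat \<Rightarrow> 'a::field \<Rightarrow> 'a" where
  "rel_trace q x = x + x ^ q"

text \<open>For \<open>q = 2 ^ m\<close> the last summand has exponent \<open>2 ^ (m - 1) = q / 2\<close>.\<close>

definition abs_trace :: "nat \<Rightarrow> 'a::field \<Rightarrow> 'a" where
  "abs_trace m x = (\<Sum>i<m. x ^ (2 ^ i))"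

definition mu :: "nat \<Rightarrow> 'a::field set" where
  "mu n = {x. x ^ n = 1}"

definition N :: "nat \<Rightarrow> 'a::field \<Rightarrow> 'a \<Rightarrow> nat" where
  "N q b c = card {x \<in> mu (q + 1) - {- 1}. rel_trace q (b * x + b) + c = 0}"

end

theory Submission
  imports Defs "HOL-Computational_Algebra.Polynomial"
begin

text \<open>
  Since \<open>\<alpha>\<^sup>q = \<alpha> + 1\<close>, the map \<open>y \<mapsto> 1 + 1 / (y + \<alpha>) = (y + \<alpha>)\<^sup>q / (y + \<alpha>)\<close> is a bijection from
  \<open>K\<close> onto \<open>\<mu> - {1}\<close>. Substituting it turns the trace condition into the quadratic equation
  \<open>c y\<^sup>2 + (b2 + c) y + b1 + c \<alpha>\<^bsup>q + 1\<^esup> = 0\<close> over \<open>K\<close>. When \<open>c \<noteq> 0\<close> and \<open>b2 \<noteq> c\<close>, the scaling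
  \<open>y = (b2 + c) z / c\<close> leads to the Artin--Schreier equation \<open>z\<^sup>2 + z = \<delta>\<close>, which is solvable
  in \<open>K\<close> iff the absolute trace of \<open>\<delta>\<close> vanishes.
\<close>

section \<open>Finite subfields and characteristic 2\<close>

text \<open>Multiplication by \<open>x\<close> permutes \<open>S\<close>, so \<open>\<Prod>S\<close>
  is unchanged when every factor is multiplied by \<open>x\<close>; cancelling it gives the claim.
  With \<open>S = K - {0}\<close> this yields Fermat's theorem for subfields.\<close>

lemma power_card_eq_1_if_mult_closed:
  fixes x :: "'a::field"
  assumes "finite S" "0 \<notin> S" "x \<noteq> 0" and closed: "\<And>y. y \<in> S \<Longrightarrow> x * y \<in> S"
  shows "x ^ card S = 1"
proof -
  have inj: "inj_on ((*) x) S"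
    using \<open>x \<noteq> 0\<close> by (auto simp: inj_on_def)
  have "(*) x ` S = S"
    using endo_inj_surj[OF \<open>finite S\<close> _ inj] closed by blast
  then have "\<Prod>S = (\<Prod>y\<in>S. x * y)"
    using prod.reindex[OF inj, of "\<lambda>y. y"] by simp
  then have "\<Prod>S = x ^ card S * \<Prod>S"
    by (simp add: prod.distrib)
  moreover have "\<Prod>S \<noteq> 0"
    using assms by (auto simp: prod_zero_iff)
  ultimately show ?thesis by simp
qed

lemma subfield_power_card:
  fixes K :: "'a::field set"
  assumes "is_subfield K" "finite K" "x \<in> K"
  shows "x ^ card K = x"
proof (cases "x = 0")
  case True
  then show ?thesis
    using assms by (auto simp: card_gt_0_iff zero_power)
next
  case False
  have "x ^ card (K - {0}) = 1"
    using assms False by (intro power_card_eq_1_if_mult_closed) (auto simp: is_subfield_def)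
  moreover have "card K = Suc (card (K - {0}))"
    using assms by (intro card.remove) (auto simp: is_subfield_def)
  ultimately show ?thesis by simp
qed

lemma subfield_divide:
  assumes "is_subfield K" "x \<in> K" "y \<in> K"
  shows "x / y \<in> K"
  using assms by (simp add: is_subfield_def divide_inverse)

lemma subfield_power:
  assumes "is_subfield K" "x \<in> K"
  shows "x ^ n \<in> K"
  using assms by (induction n) (auto simp: is_subfield_def)

text \<open>By Fermat all elements of \<open>K\<close> are roots of a polynomial of degree
  \<open>card K\<close>, which leaves no room for further roots. Membership in \<open>K\<close> can
  thus be checked by computing a power.\<close>

lemma subfield_eq_fixed_points:
  fixes K :: "'a::field set"
  assumes "is_subfield K" "finite K"
  shows "K = {x. x ^ card K = x}"
proof (rule card_seteq)
  have "{0, 1} \<subseteq> K" using assms by (auto simp: is_subfield_def)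
  then have gt: "card K > 1"
    using card_mono[OF \<open>finite K\<close>, of "{0, 1}"] by simp
  define p :: "'a poly" where "p = monom 1 (card K) - monom 1 1"
  have deg: "degree p = card K"
    unfolding p_def diff_conv_add_uminus
    using gt by (subst degree_add_eq_left) (auto simp: degree_monom_eq)
  then have nz: "p \<noteq> 0" using gt by auto
  have roots: "{x. x ^ card K = x} = {x. poly p x = 0}"
    by (simp add: p_def poly_monom)
  show "card {x::'a. x ^ card K = x} \<le> card K"
    using card_poly_roots_bound[OF nz] unfolding roots deg .
  show "finite {x::'a. x ^ card K = x}"
    unfolding roots by (rule poly_roots_finite[OF nz])
  show "K \<subseteq> {x. x ^ card K = x}"
    using subfield_power_card[OF assms] by auto
qed

text \<open>Fermat's theorem for the whole field, applied to -1, gives 1 = -1 because the exponent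
  is even.\<close>

lemma CHAR_eq_2_if_even_card:
  assumes "even CARD('a::{field,finite})"
  shows "CHAR('a) = 2"
proof -
  have "(- 1 :: 'a) ^ CARD('a) = - 1"
    by (rule subfield_power_card) (auto simp: is_subfield_def)
  then have "of_nat 2 = (0::'a)"
    using assms by (simp add: eq_neg_iff_add_eq_0)
  then have "CHAR('a) dvd 2"
    by (simp only: of_nat_eq_0_iff_char_dvd)
  then have "CHAR('a) \<le> 2" "CHAR('a) \<noteq> 0"
    using dvd_imp_le[of "CHAR('a)" 2] by (simp, metis dvd_0_left_iff zero_neq_numeral)
  moreover have "CHAR('a) \<noteq> 1" by simp
  ultimately show ?thesis by linarith
qed

lemma add_power_two_power:
  fixes x y :: "'a::field"
  assumes "CHAR('a) = 2"
  shows "(x + y) ^ 2 ^ n = x ^ 2 ^ n + y ^ 2 ^ n"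
  using freshmans_dream'[where ?'a = 'a, of "2 ^ n" n x y] assms by simp

lemma add_eq_0_iff_CHAR_2:
  fixes x y :: "'a::field"
  assumes "CHAR('a) = 2"
  shows "x + y = 0 \<longleftrightarrow> x = y"
  using uminus_CHAR_2[OF assms, of y] by (metis eq_neg_iff_add_eq_0)

lemma two_eq_0_CHAR_2:
  assumes "CHAR('a::field) = 2"
  shows "(2::'a) = 0"
  using of_nat_CHAR[where ?'a = 'a] assms by simp

section \<open>Absolute trace, Artin--Schreier equation and square roots\<close>

text \<open>The sum telescopes: squaring shifts the summands of the trace by one place, and equal
  terms cancel in characteristic 2. For \<open>z\<close> in a field with \<open>2 ^ m\<close>
  elements the right-hand side is \<open>z + z = 0\<close>.\<close>

lemma abs_trace_square_add:
  fixes z :: "'a::field"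
  assumes "CHAR('a) = 2"
  shows "abs_trace m (z\<^sup>2 + z) = z ^ 2 ^ m + z"
proof (induction m)
  case 0
  show ?case using assms by (simp add: abs_trace_def two_eq_0_CHAR_2)
next
  case (Suc m)
  have "abs_trace (Suc m) (z\<^sup>2 + z) = abs_trace m (z\<^sup>2 + z) + (z\<^sup>2 + z) ^ 2 ^ m"
    by (simp add: abs_trace_def)
  also have "\<dots> = (z ^ 2 ^ m + z) + (z ^ 2 ^ Suc m + z ^ 2 ^ m)"
    using Suc assms by (simp add: add_power_two_power flip: power_mult)
  also have "\<dots> = (z ^ 2 ^ m + z ^ 2 ^ m) + (z ^ 2 ^ Suc m + z)"
    by (simp add: algebra_simps)
  also have "z ^ 2 ^ m + z ^ 2 ^ m = 0"
    using assms by (simp add: two_eq_0_CHAR_2)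
  finally show ?case by simp
qed

text \<open>The difference of the two sides factors as \<open>(y - z) * (y + z + 1)\<close>.\<close>

lemma square_add_eq_iff:
  fixes y z :: "'a::field"
  assumes "CHAR('a) = 2"
  shows "y\<^sup>2 + y = z\<^sup>2 + z \<longleftrightarrow> y = z \<or> y = z + 1"
proof -
  have "y\<^sup>2 + y - (z\<^sup>2 + z) = (y - z) * (y + z + 1)"
    by (simp add: algebra_simps power2_eq_square)
  moreover have "y + z + 1 = 0 \<longleftrightarrow> y = z + 1"
    using add_eq_0_iff_CHAR_2[OF assms, of y "z + 1"] by (simp add: add.assoc)
  ultimately show ?thesis by (metis eq_iff_diff_eq_0 mult_eq_0_iff)
qed

text \<open>The trace is a polynomial function of degree at most \<open>2 ^ (m - 1)\<close>, which
  bounds its number of roots.\<close>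

lemma card_abs_trace_kernel:
  assumes "m \<ge> 1"
  shows "finite {x::'a::field. abs_trace m x = 0}"
    and "card {x::'a. abs_trace m x = 0} \<le> 2 ^ (m - 1)"
proof -
  define p :: "'a poly" where "p = (\<Sum>i<m. monom 1 (2 ^ i))"
  \<comment> \<open>Only the last summand contributes to this coefficient; it witnesses that
    \<open>p\<close> is nonzero.\<close>
  have coeff: "coeff p (2 ^ (m - 1)) = 1"
  proof -
    have "coeff p (2 ^ (m - 1)) = (\<Sum>i<m. if i = m - 1 then 1 else 0)"
      by (simp add: p_def coeff_sum)
    also have "\<dots> = 1" using assms by simp
    finally show ?thesis .
  qed
  then have nz: "p \<noteq> 0" by auto
  have "degree p \<le> 2 ^ (m - 1)"
    unfolding p_def
  proof (rule degree_sum_le)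
    fix i assume "i \<in> {..<m}"
    then have "(2::nat) ^ i \<le> 2 ^ (m - 1)"
      by (intro power_increasing) auto
    then show "degree (monom (1::'a) (2 ^ i)) \<le> 2 ^ (m - 1)"
      by (simp add: degree_monom_eq)
  qed simp
  moreover have roots: "{x. abs_trace m x = 0} = {x. poly p x = 0}"
    by (simp add: p_def abs_trace_def poly_sum poly_monom)
  ultimately show "card {x::'a. abs_trace m x = 0} \<le> 2 ^ (m - 1)"
    using card_poly_roots_bound[OF nz] by simp
  show "finite {x::'a. abs_trace m x = 0}"
    using poly_roots_finite[OF nz] roots by simp
qed

text \<open>
  The image of \<open>z \<mapsto> z\<^sup>2 + z\<close> on \<open>K\<close> has at least \<open>q / 2\<close> elements, as all fibres have size at most 2,
  and it lies in the kernel of the trace, which has at most \<open>q / 2\<close> elements.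
\<close>

lemma abs_trace_eq_0_imp_Artin_Schreier:
  fixes K :: "'a::field set"
  assumes char: "CHAR('a) = 2" and "is_subfield K" "finite K" "card K = 2 ^ m" "m \<ge> 1"
    and "abs_trace m d = 0"
  obtains z where "z \<in> K" "z\<^sup>2 + z = d"
proof -
  define f :: "'a \<Rightarrow> 'a" where "f = (\<lambda>z. z\<^sup>2 + z)"
  have "f ` K = {x. abs_trace m x = 0}"
  proof (rule card_seteq)
    show "finite {x::'a. abs_trace m x = 0}"
      by (rule card_abs_trace_kernel) fact
    show "f ` K \<subseteq> {x. abs_trace m x = 0}"
    proof safe
      fix z assume "z \<in> K"
      then have "z ^ 2 ^ m = z"
        using subfield_power_card[of K z] assms by simp
      then show "abs_trace m (f z) = 0"
        by (simp add: f_def abs_trace_square_add char two_eq_0_CHAR_2)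
    qed
    have fibre: "card (f -` {w} \<inter> K) \<le> 2" if "w \<in> f ` K" for w
    proof -
      from that obtain z where "w = f z" by auto
      then have "f -` {w} \<inter> K \<subseteq> {z, z + 1}"
        using square_add_eq_iff[OF char] by (auto simp: f_def)
      then have "card (f -` {w} \<inter> K) \<le> card {z, z + 1}"
        by (intro card_mono) auto
      then show ?thesis by simp
    qed
    have "2 ^ m = card (\<Union>w\<in>f ` K. f -` {w} \<inter> K)"
      using assms by (intro trans[OF assms(4)[symmetric]] arg_cong[where f = card]) auto
    also have "\<dots> \<le> (\<Sum>w\<in>f ` K. card (f -` {w} \<inter> K))"
      using assms by (intro card_UN_le) auto
    also have "\<dots> \<le> card (f ` K) * 2"
      using sum_bounded_above[of "f ` K" "\<lambda>w. card (f -` {w} \<inter> K)" 2] fibre by simp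
    finally have "2 ^ (m - 1) \<le> card (f ` K)"
      using \<open>m \<ge> 1\<close> by (cases m) auto
    then show "card {x::'a. abs_trace m x = 0} \<le> card (f ` K)"
      using card_abs_trace_kernel(2)[OF \<open>m \<ge> 1\<close>, where ?'a = 'a] by linarith
  qed
  with \<open>abs_trace m d = 0\<close> have "d \<in> f ` K" by simp
  with that show thesis
    by (auto simp: f_def)
qed

text \<open>One solution \<open>z\<close> in \<open>K\<close> yields exactly the pair
  \<open>z\<close>, \<open>z + 1\<close>; any solution in \<open>K\<close> forces the trace of
  \<open>d\<close> to be \<open>z + z = 0\<close>.\<close>

lemma card_Artin_Schreier:
  fixes K :: "'a::field set"
  assumes char: "CHAR('a) = 2" and K: "is_subfield K" "finite K" "card K = 2 ^ m" "m \<ge> 1"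
  shows "abs_trace m d = 0 \<Longrightarrow> card {z \<in> K. z\<^sup>2 + z = d} = 2"
    and "abs_trace m d \<noteq> 0 \<Longrightarrow> card {z \<in> K. z\<^sup>2 + z = d} = 0"
proof -
  assume "abs_trace m d = 0"
  then obtain z where z: "z \<in> K" "z\<^sup>2 + z = d"
    using abs_trace_eq_0_imp_Artin_Schreier assms by metis
  then have "{z \<in> K. z\<^sup>2 + z = d} = {z, z + 1}"
    using square_add_eq_iff[OF char, of _ z] K(1) by (auto simp: is_subfield_def)
  then show "card {z \<in> K. z\<^sup>2 + z = d} = 2" by simp
next
  assume nz: "abs_trace m d \<noteq> 0"
  have "z\<^sup>2 + z \<noteq> d" if "z \<in> K" for z
  proof
    assume "z\<^sup>2 + z = d"
    moreover have "z ^ 2 ^ m = z"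
      using subfield_power_card[of K z] assms that by simp
    ultimately show False
      using nz abs_trace_square_add[OF char, of m z] by (simp add: two_eq_0_CHAR_2 char)
  qed
  then have "{z \<in> K. z\<^sup>2 + z = d} = {}" by auto
  then show "card {z \<in> K. z\<^sup>2 + z = d} = 0" by (simp only: card.empty)
qed

text \<open>Squaring is injective in characteristic 2, hence a permutation of the finite set
  \<open>K\<close>. The singleton form lets the count 1 be read off when the linear term of the
  quadratic vanishes.\<close>

lemma ex1_square_root_CHAR_2:
  fixes K :: "'a::field set"
  assumes char: "CHAR('a) = 2" and "is_subfield K" "finite K" "d \<in> K"
  shows "\<exists>y. {y \<in> K. y\<^sup>2 = d} = {y}"
proof -
  have eq: "x = y" if "x\<^sup>2 = y\<^sup>2" for x y :: 'a
  proof -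
    have "(x + y)\<^sup>2 = 0"
      using that add_power_two_power[OF char, of x y 1] by (simp add: two_eq_0_CHAR_2 char)
    then show ?thesis by (simp add: add_eq_0_iff_CHAR_2 char)
  qed
  then have "inj_on (\<lambda>y. y\<^sup>2) K" by (rule inj_onI)
  moreover have "(\<lambda>y. y\<^sup>2) ` K \<subseteq> K"
    using subfield_power[OF \<open>is_subfield K\<close>] by auto
  ultimately have "(\<lambda>y. y\<^sup>2) ` K = K"
    using endo_inj_surj[OF \<open>finite K\<close>] by blast
  then obtain y where "y \<in> K" "y\<^sup>2 = d"
    using \<open>d \<in> K\<close> by (metis imageE)
  with eq have "{y \<in> K. y\<^sup>2 = d} = {y}" by blast
  then show ?thesis ..
qed

section \<open>Parametrising \<open>mu (q + 1)\<close> and reduction to a quadratic\<close>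

lemma card_Collect_image:
  assumes "g ` A = B" "inj_on g A" "\<And>y. y \<in> A \<Longrightarrow> Q (g y) \<longleftrightarrow> P y"
  shows "card {x \<in> B. Q x} = card {y \<in> A. P y}"
proof -
  have "{x \<in> B. Q x} = g ` {y \<in> A. P y}"
    using assms(1,3) by auto
  moreover have "inj_on g {y \<in> A. P y}"
    using assms(2) by (rule inj_on_subset) auto
  ultimately show ?thesis by (simp add: card_image)
qed

text \<open>Raising to the power \<open>q\<close> fixes \<open>b1\<close>, \<open>b2\<close>,
  \<open>y\<close> and sends \<alpha> to \<alpha> + 1. The two conjugate fractions have the norm of
  \<open>y + \<alpha>\<close> as common denominator.\<close>

lemma rel_trace_divide:
  fixes \<alpha> b1 b2 y :: "'a::field"
  assumes char: "CHAR('a) = 2" and q: "q = 2 ^ m"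
    and \<alpha>: "\<alpha> ^ q = \<alpha> + 1" and fixed: "b1 ^ q = b1" "b2 ^ q = b2" "y ^ q = y"
    and nz: "y + \<alpha> \<noteq> 0" "y + \<alpha> + 1 \<noteq> 0"
  shows "rel_trace q ((b1 + b2 * \<alpha>) / (y + \<alpha>)) = (b1 + b2 * y) / (y\<^sup>2 + y + \<alpha> ^ (q + 1))"
proof -
  have pow_add: "(u + v) ^ q = u ^ q + v ^ q" for u v :: 'a
    using add_power_two_power[OF char] q by simp
  have two: "(2::'a) = 0"
    by (rule two_eq_0_CHAR_2[OF char])
  \<comment> \<open>\<open>u\<close> collects the terms that occur twice in the combined numerator
    and so cancel.\<close>
  define u where "u = b1 * y + b1 * \<alpha> + b2 * \<alpha> * y + b2 * \<alpha> * \<alpha> + b2 * \<alpha>"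
  have "rel_trace q ((b1 + b2 * \<alpha>) / (y + \<alpha>))
      = (b1 + b2 * \<alpha>) / (y + \<alpha>) + (b1 + b2 * (\<alpha> + 1)) / (y + \<alpha> + 1)"
    by (simp add: rel_trace_def power_divide power_mult_distrib pow_add \<alpha> fixed add.assoc)
  also have "\<dots> = ((b1 + b2 * \<alpha>) * (y + \<alpha> + 1) + (b1 + b2 * (\<alpha> + 1)) * (y + \<alpha>))
      / ((y + \<alpha>) * (y + \<alpha> + 1))"
    using nz by (simp add: add_frac_eq)
  also have "(b1 + b2 * \<alpha>) * (y + \<alpha> + 1) + (b1 + b2 * (\<alpha> + 1)) * (y + \<alpha>)
      = (b1 + b2 * y) + (u + u)"
    unfolding u_def by (simp add: algebra_simps)
  also have "(y + \<alpha>) * (y + \<alpha> + 1) = y\<^sup>2 + y + \<alpha> ^ (q + 1) + (y * \<alpha> + y * \<alpha>)"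
    using \<alpha> by (simp add: algebra_simps power2_eq_square)
  finally show ?thesis by (simp add: two)
qed

lemma N_eq_card_quadratic:
  fixes \<alpha> b1 b2 c :: "'a::field"
  assumes char: "CHAR('a) = 2" and q: "q = 2 ^ m" and K: "K = {x. x ^ q = x}"
    and "\<alpha> \<notin> K" "rel_trace q \<alpha> = 1" "b1 \<in> K" "b2 \<in> K"
  shows "N q (b1 + b2 * \<alpha>) c = card {y \<in> K. c * y\<^sup>2 + (b2 + c) * y + (b1 + c * \<alpha> ^ (q + 1)) = 0}"
proof -
  have add0: "u + v = 0 \<longleftrightarrow> u = v" for u v :: 'a
    by (rule add_eq_0_iff_CHAR_2[OF char])
  have two: "(2::'a) = 0"
    by (rule two_eq_0_CHAR_2[OF char])
  have dbl: "u + u = 0" "u + (u + v) = v" for u v :: 'a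
    using two by (simp_all flip: add.assoc)
  have neg1: "- 1 = (1::'a)"
    by (rule uminus_CHAR_2[OF char])
  have pow_add: "(u + v) ^ q = u ^ q + v ^ q" for u v :: 'a
    using add_power_two_power[OF char] q by simp
  have \<alpha>: "\<alpha> ^ q = \<alpha> + 1"
    using assms(5) dbl(2)[of \<alpha> "\<alpha> ^ q"] by (simp add: rel_trace_def)
  have nz: "y + \<alpha> \<noteq> 0" "y + \<alpha> + 1 \<noteq> 0" if "y \<in> K" for y
  proof -
    show "y + \<alpha> \<noteq> 0"
      using that \<open>\<alpha> \<notin> K\<close> add0 by auto
    \<comment> \<open>The second factor is the conjugate of the first, so it is nonzero as
      well.\<close>
    have "y + \<alpha> + 1 = (y + \<alpha>) ^ q"
      using that \<alpha> by (simp add: K pow_add)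
    with \<open>y + \<alpha> \<noteq> 0\<close> show "y + \<alpha> + 1 \<noteq> 0" by simp
  qed
  define g where "g = (\<lambda>y. 1 + 1 / (y + \<alpha>))"
  have mu: "g y \<in> mu (q + 1) - {- 1}" if "y \<in> K" for y
  proof -
    have g: "g y = (y + \<alpha> + 1) / (y + \<alpha>)"
      using nz[OF that] by (simp add: g_def field_simps)
    have "(y + \<alpha> + 1) ^ q = y + \<alpha>"
      using that \<alpha> two by (simp add: K pow_add add.assoc)
    moreover have "(y + \<alpha>) ^ q = y + \<alpha> + 1"
      using that \<alpha> by (simp add: K pow_add add.assoc)
    ultimately have "g y ^ (q + 1) = 1"
      using nz[OF that] unfolding g by (simp add: power_divide)
    moreover have "g y \<noteq> 1" using nz[OF that] by (simp add: g_def)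
    ultimately show ?thesis by (simp add: mu_def neg1)
  qed
  have trace: "rel_trace q ((b1 + b2 * \<alpha>) * g y + (b1 + b2 * \<alpha>)) + c = 0
      \<longleftrightarrow> c * y\<^sup>2 + (b2 + c) * y + (b1 + c * \<alpha> ^ (q + 1)) = 0" if "y \<in> K" for y
  proof -
    \<comment> \<open>\<open>D\<close> is the norm
      \<open>(y + \<alpha>) * (y + \<alpha> + 1)\<close>; clearing this denominator produces the
      quadratic.\<close>
    define D where "D = y\<^sup>2 + y + \<alpha> ^ (q + 1)"
    have d: "D \<noteq> 0"
    proof -
      have "D = (y + \<alpha>) * (y + \<alpha> + 1) - (y * \<alpha> + y * \<alpha>)"
        using \<alpha> by (simp add: D_def algebra_simps power2_eq_square)
      then show ?thesis using nz[OF that] by (simp add: dbl two)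
    qed
    \<comment> \<open>The summand 1 in \<open>g y\<close> cancels the added constant
      \<open>b\<close>.\<close>
    have "(b1 + b2 * \<alpha>) * g y + (b1 + b2 * \<alpha>)
        = (b1 + b2 * \<alpha>) / (y + \<alpha>) + ((b1 + b2 * \<alpha>) + (b1 + b2 * \<alpha>))"
      by (simp add: g_def distrib_left)
    also have "\<dots> = (b1 + b2 * \<alpha>) / (y + \<alpha>)"
      by (simp only: dbl add_0_right)
    finally have "rel_trace q ((b1 + b2 * \<alpha>) * g y + (b1 + b2 * \<alpha>))
        = (b1 + b2 * y) / D"
      using rel_trace_divide[OF char q \<alpha>, of b1 b2 y] nz[OF that] that assms by (simp add: D_def)
    then have "rel_trace q ((b1 + b2 * \<alpha>) * g y + (b1 + b2 * \<alpha>)) + c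
        = ((b1 + b2 * y) + c * D) / D"
      using d by (simp add: add_divide_distrib)
    moreover have "(b1 + b2 * y) + c * D
        = c * y\<^sup>2 + (b2 + c) * y + (b1 + c * \<alpha> ^ (q + 1))"
      by (simp add: D_def algebra_simps)
    ultimately show ?thesis using d by (simp only: divide_eq_0_iff simp_thms)
  qed
  have surj: "x \<in> g ` K" if "x \<in> mu (q + 1) - {- 1}" for x
  proof
    have x1: "x ^ (q + 1) = 1" "x \<noteq> 1"
      using that by (auto simp: mu_def neg1)
    then have "x \<noteq> 0" by auto
    have "x + 1 \<noteq> 0" using x1 add0 by simp
    have xq: "x ^ q = 1 / x"
      using x1 \<open>x \<noteq> 0\<close> by (simp add: field_simps)
    \<comment> \<open>This solves \<open>x = 1 + 1 / (y + \<alpha>)\<close> for \<open>y\<close>,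
      with signs irrelevant in characteristic 2.\<close>
    define y where "y = 1 / (x + 1) + \<alpha>"
    have ya: "y + \<alpha> = 1 / (x + 1)"
      by (simp add: y_def add.assoc dbl two)
    then show "x = g y"
      using \<open>x + 1 \<noteq> 0\<close> dbl(2)[of 1 x] by (simp add: g_def add.commute)
    have "y ^ q = 1 / (1 / x + 1) + (\<alpha> + 1)"
      by (simp add: y_def pow_add power_divide xq \<alpha>)
    also have "1 / (1 / x + 1) = x / (x + 1)"
      using \<open>x \<noteq> 0\<close> by (simp add: add_divide_eq_iff add.commute)
    also have "x / (x + 1) + (\<alpha> + 1) = (x + 1 + x) / (x + 1) + \<alpha>"
      using \<open>x + 1 \<noteq> 0\<close> by (simp add: field_simps)
    also have "x + 1 + x = 1"
      using dbl(2)[of x 1] by (simp add: add_ac)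
    finally have "y ^ q = y" by (simp add: y_def)
    then show "y \<in> K" by (simp add: K)
  qed
  have "g ` K = mu (q + 1) - {- 1}"
    by (intro equalityI image_subsetI subsetI mu surj)
  moreover have "inj_on g K"
    by (intro inj_onI) (simp add: g_def)
  ultimately show ?thesis
    unfolding N_def using trace by (rule card_Collect_image)
qed

section \<open>Counting the roots of the quadratic case by case\<close>

theorem theorem1:
  fixes q m :: nat
    and K :: "'a::{field,finite} set"
    and \<alpha> b1 b2 b c \<delta> :: 'a
  assumes "m \<ge> 1" and "q = 2 ^ m"
    and "CARD('a) = q ^ 2"
    and "is_subfield K" and "card K = q"
    and "\<alpha> \<notin> K" and "rel_trace q \<alpha> = 1"
    and "b1 \<in> K" and "b2 \<in> K" and "c \<in> K"
    and "b = b1 + b2 * \<alpha>"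
    and "b2 \<noteq> c \<longrightarrow> \<delta> = (c ^ 2 * \<alpha> ^ (q + 1) + c * b1) / (b2 + c) ^ 2"
  shows "(b2 \<noteq> c \<longrightarrow> \<delta> \<in> K) \<and>
    (b = 0 \<and> c = 0 \<longrightarrow> N q b c = q) \<and>
    (b = 0 \<and> c \<noteq> 0 \<longrightarrow> N q b c = 0) \<and>
    (b \<noteq> 0 \<and> c = 0 \<and> b2 = 0 \<longrightarrow> N q b c = 0) \<and>
    (b \<noteq> 0 \<and> c = 0 \<and> b2 \<noteq> 0 \<longrightarrow> N q b c = 1) \<and>
    (b \<noteq> 0 \<and> c \<noteq> 0 \<and> b2 = c \<longrightarrow> N q b c = 1) \<and>
    (b \<noteq> 0 \<and> c \<noteq> 0 \<and> b2 \<noteq> c \<and> abs_trace m \<delta> = 1 \<longrightarrow> N q b c = 0) \<and>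
    (b \<noteq> 0 \<and> c \<noteq> 0 \<and> b2 \<noteq> c \<and> abs_trace m \<delta> = 0 \<longrightarrow> N q b c = 2)"
proof -
  define n where "n = \<alpha> ^ (q + 1)"
  have char: "CHAR('a) = 2"
    using assms(1-3) by (intro CHAR_eq_2_if_even_card) simp
  have add0: "u + v = 0 \<longleftrightarrow> u = v" for u v :: 'a
    by (rule add_eq_0_iff_CHAR_2[OF char])
  have two: "(2::'a) = 0"
    by (rule two_eq_0_CHAR_2[OF char])
  have dbl: "u + u = 0" "u + (u + v) = v" for u v :: 'a
    using two by (simp_all flip: add.assoc)
  have fin: "finite K" by simp
  have fixed: "K = {x. x ^ q = x}"
    using subfield_eq_fixed_points[OF assms(4) fin] assms(5) by simp
  have add_K: "x + y \<in> K" and mult_K: "x * y \<in> K" if "x \<in> K" "y \<in> K" for x y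
    using assms(4) that by (auto simp: is_subfield_def)
  note div_K = subfield_divide[OF assms(4)] and pow_K = subfield_power[OF assms(4)]
  have \<alpha>: "\<alpha> ^ q = \<alpha> + 1"
    using assms(7) dbl(2)[of \<alpha> "\<alpha> ^ q"] by (simp add: rel_trace_def)
  have pow_add: "(u + v) ^ q = u ^ q + v ^ q" for u v :: 'a
    using add_power_two_power[OF char] assms(2) by simp
  \<comment> \<open>Conjugation swaps \<alpha> and \<alpha> + 1, whose product is
    \<open>n\<close>.\<close>
  have n_K: "n \<in> K"
    using \<alpha> dbl two by (simp add: n_def fixed power_mult_distrib pow_add add.assoc mult.commute)
  have \<delta>_K: "b2 \<noteq> c \<longrightarrow> \<delta> \<in> K"
    using assms(8-10,12) n_K unfolding n_def[symmetric] by (metis add_K mult_K div_K pow_K)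
  have N: "N q b c = card {y \<in> K. c * y\<^sup>2 + (b2 + c) * y + (b1 + c * n) = 0}"
    using N_eq_card_quadratic[OF char assms(2) fixed assms(6-9)] assms(11) by (simp add: n_def)
  \<comment> \<open>A nonzero \<open>b2\<close> would put \<open>\<alpha> = b1 / b2\<close> into
    \<open>K\<close>.\<close>
  have b_0: "b1 = 0 \<and> b2 = 0" if "b = 0"
  proof (cases "b2 = 0")
    case False
    then have "\<alpha> = b1 / b2"
      using that assms(11) by (simp add: add0 field_simps)
    with assms div_K show ?thesis by blast
  qed (use that assms in simp)
  have "N q b c = q" if "b = 0" "c = 0"
    using N b_0 that assms(5) by simp
  moreover have "N q b c = 0" if "b = 0" "c \<noteq> 0"
  proof -
    have "c * y\<^sup>2 + (b2 + c) * y + (b1 + c * n) \<noteq> 0" if "y \<in> K" for y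
    proof -
      \<comment> \<open>For \<open>b = 0\<close> the quadratic is \<open>c\<close> times the norm of
        \<open>y + \<alpha>\<close>, which does not vanish.\<close>
      have "c * y\<^sup>2 + (b2 + c) * y + (b1 + c * n) = c * ((y + \<alpha>) * (y + \<alpha> + 1) - (y * \<alpha> + y * \<alpha>))"
        using b_0[OF \<open>b = 0\<close>] \<alpha> by (simp add: n_def algebra_simps power2_eq_square)
      also have "\<dots> = c * ((y + \<alpha>) * (y + \<alpha> + 1))"
        by (simp only: dbl diff_0_right)
      also have "y + \<alpha> + 1 = (y + \<alpha>) ^ q"
        using \<open>y \<in> K\<close> \<alpha> by (simp add: fixed pow_add)
      finally show ?thesis
        using \<open>c \<noteq> 0\<close> \<open>y \<in> K\<close> \<open>\<alpha> \<notin> K\<close> by (auto simp: add0)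
    qed
    then show ?thesis by (simp add: N)
  qed
  moreover have "N q b c = 0" if "b \<noteq> 0" "c = 0" "b2 = 0"
    using N assms(11) that by simp
  moreover have "N q b c = 1" if "c = 0" "b2 \<noteq> 0"
  proof -
    have "{y \<in> K. c * y\<^sup>2 + (b2 + c) * y + (b1 + c * n) = 0} = {b1 / b2}"
      using that assms div_K by (auto simp: add0 field_simps)
    then show ?thesis by (simp add: N)
  qed
  moreover have "N q b c = 1" if "c \<noteq> 0" "b2 = c"
  proof -
    have "(b1 + c * n) / c \<in> K"
      using assms n_K by (simp add: add_K mult_K div_K)
    then obtain y where "{y \<in> K. y\<^sup>2 = (b1 + c * n) / c} = {y}"
      using ex1_square_root_CHAR_2[OF char assms(4) fin] by blast
    moreover have "c * y\<^sup>2 + (b2 + c) * y + (b1 + c * n) = 0 \<longleftrightarrow> y\<^sup>2 = (b1 + c * n) / c" for y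
      using that by (simp add: dbl add0 eq_divide_eq mult.commute)
    ultimately show ?thesis by (simp add: N)
  qed
  moreover have "N q b c = card {z \<in> K. z\<^sup>2 + z = \<delta>}" if "c \<noteq> 0" "b2 \<noteq> c"
  proof -
    define s where "s = b2 + c"
    have "s \<noteq> 0" using that add0 by (simp add: s_def)
    have "s \<in> K" using assms add_K by (simp add: s_def)
    have \<delta>: "\<delta> = c * (b1 + c * n) / s\<^sup>2"
      using assms(12) that by (simp add: s_def n_def algebra_simps power2_eq_square)
    have eq: "c * y\<^sup>2 + s * y + (b1 + c * n) = 0 \<longleftrightarrow> (c * y / s)\<^sup>2 + c * y / s = \<delta>" for y
    proof -
      \<comment> \<open>The factor \<open>c / s\<^sup>2\<close> turns the quadratic into a monic one
        in \<open>c * y / s\<close> whose linear coefficient is 1.\<close>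
      have "(c * y / s)\<^sup>2 + c * y / s + \<delta> = c / s\<^sup>2 * (c * y\<^sup>2 + s * y + (b1 + c * n))"
        using \<open>s \<noteq> 0\<close> by (simp add: \<delta> field_simps power2_eq_square)
      moreover have "c / s\<^sup>2 \<noteq> 0"
        using \<open>s \<noteq> 0\<close> \<open>c \<noteq> 0\<close> by simp
      ultimately show ?thesis
        by (metis add0 mult_eq_0_iff)
    qed
    have "bij_betw (\<lambda>y. c * y / s) {y \<in> K. c * y\<^sup>2 + s * y + (b1 + c * n) = 0} {z \<in> K. z\<^sup>2 + z = \<delta>}"
    proof (rule bij_betw_byWitness[where f' = "\<lambda>z. s * z / c"])
      have inv: "c * (s * z / c) / s = z" for z
        using \<open>s \<noteq> 0\<close> \<open>c \<noteq> 0\<close> by simp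
      show "(\<lambda>z. s * z / c) ` {z \<in> K. z\<^sup>2 + z = \<delta>}
          \<subseteq> {y \<in> K. c * y\<^sup>2 + s * y + (b1 + c * n) = 0}"
        unfolding eq using \<open>s \<in> K\<close> \<open>c \<in> K\<close> inv mult_K div_K by auto
      show "\<forall>z\<in>{z \<in> K. z\<^sup>2 + z = \<delta>}. c * (s * z / c) / s = z"
        using inv by blast
      show "(\<lambda>y. c * y / s) ` {y \<in> K. c * y\<^sup>2 + s * y + (b1 + c * n) = 0}
          \<subseteq> {z \<in> K. z\<^sup>2 + z = \<delta>}"
        unfolding eq using \<open>s \<in> K\<close> \<open>c \<in> K\<close> mult_K div_K by auto
    qed (use \<open>s \<noteq> 0\<close> \<open>c \<noteq> 0\<close> in simp)
    then show ?thesis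
      using bij_betw_same_card N by (simp add: s_def)
  qed
  ultimately show ?thesis
    using \<delta>_K card_Artin_Schreier[OF char assms(4) fin _ assms(1), of \<delta>] assms(2,5) by auto
qed

end
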